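(* For every $\varepsilon>0$ there exists $x\in(1,1+\varepsilon)$ for which the set $\mathbf S_x=\{\lfloor x^n\rfloor : n\in\mathbb N\}$ is not tail Sidon.
   Context: $\mathbb N$ denotes the positive integers. A set $A\subset\mathbb N$ is called a Sidon set if the equation $a+b=c+d$ has no non-trivial solutions in $A$, i.e. whenever $a,b,c,d\in A$ satisfy $a+b=c+d$, one has $\{a,b\}=\{c,d\}$. For real $x>1$, put $\mathbf S_x:=\{\lfloor x^n\rfloor : n\in\mathbb N\}$. The set $\mathbf S_x$ is called tail Sidon if there exists $N_0$ such that the set $\{\lfloor x^n\rfloor : n\ge N_0\}$ is a Sidon set. *)

theory Defs
  imports Complex_Main
begin

definition sidon :: "nat set \<Rightarrow> bool" where
  "sidon A \<longleftrightarrow>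
     (\<forall>a\<in>A. \<forall>b\<in>A. \<forall>c\<in>A. \<forall>d\<in>A. a + b = c + d \<longrightarrow> {a, b} = {c, d})"

(* For x > 1 all the powers are at least 1, so nat loses nothing and the values are
   positive integers. *)
definition floor_pow :: "real \<Rightarrow> nat \<Rightarrow> nat" where
  "floor_pow x n = nat \<lfloor>x ^ n\<rfloor>"

(* Being tail Sidon refers to the enumeration n \<mapsto> \<lfloor>x ^ n\<rfloor> of the set
   S_x = floor_pow x ` {1..}, hence the argument is x and not the set alone.
   The exponents range over the positive integers, hence 1 \<le> N0. *)
definition tail_sidon :: "real \<Rightarrow> bool" where
  "tail_sidon x \<longleftrightarrow> (\<exists>N0\<ge>1. sidon (floor_pow x ` {N0..}))"

end

theory Submission
  imports Defs
begin

text \<open>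
  If \<open>x ^ m = \<rho>\<close>, then the floors of the powers of \<open>\<rho>\<close> occur among those of \<open>x\<close>, so it suffices
  to find one \<open>\<rho> > 1\<close> that is not tail Sidon and to take \<open>m\<close>-th roots. The plastic number
  \<open>\<rho>\<^sup>3 = \<rho> + 1\<close> works. It satisfies \<open>\<rho> ^ (n+4) + \<rho> ^ n = \<rho> ^ (n+3) + \<rho> ^ (n+2)\<close>, and, being a
  Pisot number, \<open>\<rho> ^ n = p n - e n\<close> with \<open>p\<close> the Perrin numbers and \<open>e n\<close> tending to \<open>0\<close>; hence the
  floor is eventually \<open>p n - 1\<close> or \<open>p n\<close> according to whether \<open>e n > 0\<close>. The relation passes to the
  floors whenever the signs of the errors are balanced. As \<open>e\<close> satisfies
  \<open>e (n+3) = e (n+1) + e n\<close> and \<open>e (n+5) = e (n+4) + e n\<close>, its sign sequence is balanced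
  infinitely often for purely combinatorial reasons.
\<close>

lemma sidon_subset: "A \<subseteq> B \<Longrightarrow> sidon B \<Longrightarrow> sidon A"
  unfolding sidon_def by (meson subsetD)

lemma tail_sidon_power:
  assumes "tail_sidon x" and "m \<ge> 1"
  shows "tail_sidon (x ^ m)"
proof -
  obtain N where N: "N \<ge> 1" "sidon (floor_pow x ` {N..})"
    using assms(1) unfolding tail_sidon_def by blast
  have "floor_pow (x ^ m) ` {N..} \<subseteq> floor_pow x ` {N..}"
  proof
    fix y assume "y \<in> floor_pow (x ^ m) ` {N..}"
    then obtain n where n: "n \<ge> N" "y = floor_pow (x ^ m) n" by auto
    have "m * n \<ge> N"
      using n(1) assms(2) by (metis le_trans mult_le_mono1 mult_1)
    moreover have "y = floor_pow x (m * n)"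
      using n(2) by (simp add: floor_pow_def power_mult)
    ultimately show "y \<in> floor_pow x ` {N..}" by auto
  qed
  then have "sidon (floor_pow (x ^ m) ` {N..})"
    using N(2) by (rule sidon_subset)
  then show ?thesis
    using N(1) unfolding tail_sidon_def by blast
qed

lemma balanced_signs:
  fixes s :: "nat \<Rightarrow> bool"
  assumes r3: "\<And>n. s n = s (n+1) \<Longrightarrow> s (n+3) = s n"
    and r5: "\<And>n. s n = s (n+4) \<Longrightarrow> s (n+5) = s n"
  shows "\<exists>n\<ge>N. (of_bool (s (n+4)) + of_bool (s n) :: int) = of_bool (s (n+3)) + of_bool (s (n+2))"
proof -
  define B where "B n \<longleftrightarrow>
    (of_bool (s (n+4)) + of_bool (s n) :: int) = of_bool (s (n+3)) + of_bool (s (n+2))" for n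
  \<comment> \<open>Here \<open>s (i+3)\<close> agrees with \<open>s i\<close>, so
    \<open>B i\<close> can fail only if \<open>s (i+2)\<close> differs from \<open>s i\<close> and
    \<open>s (i+4)\<close> agrees with it; then the value of \<open>s (i+5)\<close> decides between
    \<open>B (i+2)\<close> and \<open>B (i+3)\<close>.\<close>
  have *: "B i \<or> B (i+2) \<or> B (i+3)" if "s i = s (i+1)" for i
    using that r3[of i] r3[of "i+1"] r3[of "i+2"] r3[of "i+3"] r3[of "i+4"]
    unfolding B_def
    by (cases "s i"; cases "s (i+2)"; cases "s (i+4)"; cases "s (i+5)")
       (simp_all add: eval_nat_numeral)
  \<comment> \<open>A strictly alternating sequence would violate the second recurrence.\<close>
  have "\<exists>i\<ge>N. s i = s (i+1)"
  proof (rule ccontr)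
    assume "\<not> ?thesis"
    then have alt: "s (i+1) = (\<not> s i)" if "i \<ge> N" for i using that by blast
    show False
      using alt[of N] alt[of "N+1"] alt[of "N+2"] alt[of "N+3"] alt[of "N+4"] r5[of N]
      by (simp add: eval_nat_numeral)
  qed
  then obtain i where "i \<ge> N" "s i = s (i+1)" by blast
  with *[of i] show ?thesis
    unfolding B_def[symmetric] by (meson le_add1 le_trans)
qed

fun perrin :: "nat \<Rightarrow> int" where
  "perrin 0 = 3"
| "perrin (Suc 0) = 0"
| "perrin (Suc (Suc 0)) = 2"
| "perrin (Suc (Suc (Suc n))) = perrin (Suc n) + perrin n"

locale plastic_number =
  fixes \<rho> :: real
  assumes gt1: "\<rho> > 1" and cube: "\<rho> ^ 3 = \<rho> + 1"
begin

definition err :: "nat \<Rightarrow> real" where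
  "err n = perrin n - \<rho> ^ n"

lemma power_rec3: "\<rho> ^ (n+3) = \<rho> ^ (n+1) + \<rho> ^ n"
  by (simp only: power_add cube) (simp add: algebra_simps)

text \<open>Reflects the factorization
  \<open>X^5 - X^4 - 1 = (X^3 - X - 1) (X^2 - X + 1)\<close>.\<close>

lemma power_rec5: "\<rho> ^ (n+5) = \<rho> ^ (n+4) + \<rho> ^ n"
  using power_rec3[of n] power_rec3[of "n+1"] power_rec3[of "n+2"]
  by (simp add: eval_nat_numeral)

lemma perrin_rec3: "perrin (n+3) = perrin (n+1) + perrin n"
  by (simp add: eval_nat_numeral)

lemma err_rec3: "err (n+3) = err (n+1) + err n"
  by (simp only: err_def power_rec3 perrin_rec3)

lemma err_rec5: "err (n+5) = err (n+4) + err n"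
  using err_rec3[of n] err_rec3[of "n+1"] err_rec3[of "n+2"]
  by (simp add: eval_nat_numeral)

lemma lt2: "\<rho> < 2"
proof (rule ccontr)
  assume "\<not> \<rho> < 2"
  then have "\<rho> * \<rho> \<ge> 2 * 2" by (intro mult_mono) auto
  then have "\<rho> * (\<rho> * \<rho>) \<ge> \<rho> * 4" using gt1 by (intro mult_left_mono) auto
  with cube gt1 show False by (simp add: power3_eq_cube mult.assoc)
qed

text \<open>
  The errors satisfy the recurrence with characteristic polynomial
  \<open>(X\<^sup>3 - X - 1) / (X - \<rho>) = X\<^sup>2 + \<rho> X + 1 / \<rho>\<close>, because the Perrin numbers are the power sums of
  the roots of \<open>X\<^sup>3 - X - 1\<close>. It is cleared of denominators here.
\<close>

lemma err_rec2: "\<rho> * err (n+2) + \<rho>\<^sup>2 * err (n+1) + err n = 0"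
proof (induction n)
  case 0
  show ?case
    using cube by (simp add: err_def eval_nat_numeral algebra_simps)
next
  case (Suc n)
  have "\<rho> * err (n+3) + \<rho>\<^sup>2 * err (n+2) + err (n+1) =
        \<rho> * (\<rho> * err (n+2) + \<rho>\<^sup>2 * err (n+1) + err n) + (\<rho> + 1 - \<rho> ^ 3) * err (n+1)"
    by (simp only: err_rec3) (simp add: power2_eq_square power3_eq_cube algebra_simps)
  also have "\<dots> = 0" using Suc cube by simp
  finally show ?case by (simp add: eval_nat_numeral)
qed

text \<open>
  The quadratic form is \<open>\<rho>\<close> times the norm form of the complex conjugate pair of roots, whose
  product is \<open>1 / \<rho>\<close>, so it scales by that factor in each step.
\<close>

lemma err_norm_form:
  "\<rho> ^ n * (\<rho> * (err (n+1))\<^sup>2 + \<rho>\<^sup>2 * err (n+1) * err n + (err n)\<^sup>2) = 4 - \<rho> ^ 3"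
proof (induction n)
  case 0
  show ?case
    by (simp add: err_def power2_eq_square power3_eq_cube algebra_simps)
next
  case (Suc n)
  define u v w where "u = err n" and "v = err (n+1)" and "w = err (n+2)"
  have u: "u = - (\<rho> * w) - \<rho>\<^sup>2 * v"
    using err_rec2[of n] unfolding u_def v_def w_def by simp
  have "\<rho> * (\<rho> * w\<^sup>2 + \<rho>\<^sup>2 * w * v + v\<^sup>2) = \<rho> * v\<^sup>2 + \<rho>\<^sup>2 * v * u + u\<^sup>2"
    unfolding u by (simp add: power2_eq_square algebra_simps)
  then have "\<rho> ^ Suc n * (\<rho> * w\<^sup>2 + \<rho>\<^sup>2 * w * v + v\<^sup>2) = \<rho> ^ n * (\<rho> * v\<^sup>2 + \<rho>\<^sup>2 * v * u + u\<^sup>2)"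
    by (metis power_Suc2 mult.assoc)
  then show ?case
    using Suc by (simp only: u_def v_def w_def Suc_eq_plus1 add.assoc one_add_one)
qed

text \<open>Completing the square shows the quadratic form to be positive definite, as
  \<open>4 - \<rho> ^ 3 = 3 - \<rho> > 0\<close>; this factor cancels against the constant in
  \<open>err_norm_form\<close>.\<close>

lemma err_bound: "\<rho> ^ n * (err n)\<^sup>2 \<le> 4"
proof -
  define u v where "u = err n" and "v = err (n+1)"
  have pos: "4 - \<rho> ^ 3 > 0" using lt2 cube by simp
  have "4 * (\<rho> * v\<^sup>2 + \<rho>\<^sup>2 * v * u + u\<^sup>2) = \<rho> * (2 * v + \<rho> * u)\<^sup>2 + (4 - \<rho> ^ 3) * u\<^sup>2"
    by (simp add: power2_eq_square power3_eq_cube algebra_simps)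
  moreover have "0 \<le> \<rho> * (2 * v + \<rho> * u)\<^sup>2" using gt1 by simp
  ultimately have "(4 - \<rho> ^ 3) * u\<^sup>2 \<le> 4 * (\<rho> * v\<^sup>2 + \<rho>\<^sup>2 * v * u + u\<^sup>2)" by linarith
  then have "\<rho> ^ n * ((4 - \<rho> ^ 3) * u\<^sup>2) \<le> \<rho> ^ n * (4 * (\<rho> * v\<^sup>2 + \<rho>\<^sup>2 * v * u + u\<^sup>2))"
    using gt1 by (intro mult_left_mono) auto
  also have "\<dots> = 4 * (4 - \<rho> ^ 3)"
    using err_norm_form[of n] by (simp only: u_def v_def mult.left_commute[of _ 4])
  finally have "(4 - \<rho> ^ 3) * (\<rho> ^ n * u\<^sup>2) \<le> (4 - \<rho> ^ 3) * 4"
    by (simp add: mult_ac)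
  with pos show ?thesis
    by (simp only: u_def mult_le_cancel_left_pos)
qed

lemma floor_power_eventually:
  "\<exists>N. \<forall>n\<ge>N. \<lfloor>\<rho> ^ n\<rfloor> = perrin n - of_bool (err n > 0)"
proof -
  obtain N where N: "4 < \<rho> ^ N" using real_arch_pow[OF gt1] by blast
  have "\<lfloor>\<rho> ^ n\<rfloor> = perrin n - of_bool (err n > 0)" if "n \<ge> N" for n
  proof -
    have "\<rho> ^ N \<le> \<rho> ^ n" using gt1 that by (intro power_increasing) auto
    with N have big: "\<rho> ^ n > 4" by linarith
    have "\<bar>err n\<bar> < 1"
    proof (rule ccontr)
      assume "\<not> \<bar>err n\<bar> < 1"
      then have "1 \<le> (err n)\<^sup>2" by (metis abs_square_less_1 not_less)
      then have "\<rho> ^ n * 1 \<le> \<rho> ^ n * (err n)\<^sup>2" using big by (intro mult_left_mono) auto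
      with err_bound[of n] big show False by linarith
    qed
    moreover have "\<rho> ^ n = perrin n - err n" by (simp add: err_def)
    ultimately show ?thesis
      by (intro floor_unique) (auto simp: of_bool_def)
  qed
  then show ?thesis by blast
qed

lemma floor_relation_infinitely_often:
  "\<exists>n\<ge>N. \<lfloor>\<rho> ^ (n+4)\<rfloor> + \<lfloor>\<rho> ^ n\<rfloor> = \<lfloor>\<rho> ^ (n+3)\<rfloor> + \<lfloor>\<rho> ^ (n+2)\<rfloor>"
proof -
  obtain M where M: "\<And>n. n \<ge> M \<Longrightarrow> \<lfloor>\<rho> ^ n\<rfloor> = perrin n - of_bool (err n > 0)"
    using floor_power_eventually by blast
  \<comment> \<open>Summands of equal sign pass it on to their sum; a zero error counts as
    nonpositive, which matches the floor formula.\<close>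
  have "(err (n+3) > 0) = (err n > 0)" if "(err n > 0) = (err (n+1) > 0)" for n
    using that err_rec3[of n] by linarith
  moreover have "(err (n+5) > 0) = (err n > 0)" if "(err n > 0) = (err (n+4) > 0)" for n
    using that err_rec5[of n] by linarith
  ultimately obtain n where n: "n \<ge> max M N"
    "(of_bool (err (n+4) > 0) + of_bool (err n > 0) :: int) =
      of_bool (err (n+3) > 0) + of_bool (err (n+2) > 0)"
    using balanced_signs[of "\<lambda>n. err n > 0" "max M N"] by blast
  \<comment> \<open>Comes from \<open>X^4 - X^3 - X^2 + 1 = (X - 1) (X^3 - X - 1)\<close>.\<close>
  have "perrin (n+4) + perrin n = perrin (n+3) + perrin (n+2)"
    by (simp add: eval_nat_numeral)
  with n have "\<lfloor>\<rho> ^ (n+4)\<rfloor> + \<lfloor>\<rho> ^ n\<rfloor> = \<lfloor>\<rho> ^ (n+3)\<rfloor> + \<lfloor>\<rho> ^ (n+2)\<rfloor>"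
    using M[of "n+4"] M[of n] M[of "n+3"] M[of "n+2"] by linarith
  then show ?thesis using n(1) by (meson max.boundedE)
qed

lemma not_tail_sidon: "\<not> tail_sidon \<rho>"
proof
  assume "tail_sidon \<rho>"
  then obtain N where N: "N \<ge> 1" "sidon (floor_pow \<rho> ` {N..})"
    unfolding tail_sidon_def by blast
  obtain n where n: "n \<ge> N"
    "\<lfloor>\<rho> ^ (n+4)\<rfloor> + \<lfloor>\<rho> ^ n\<rfloor> = \<lfloor>\<rho> ^ (n+3)\<rfloor> + \<lfloor>\<rho> ^ (n+2)\<rfloor>"
    using floor_relation_infinitely_often by blast
  let ?f = "floor_pow \<rho>"
  have int_f: "int (?f k) = \<lfloor>\<rho> ^ k\<rfloor>" for k
    using gt1 by (simp add: floor_pow_def)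
  have "?f (n+4) + ?f n = ?f (n+3) + ?f (n+2)"
    using n(2) int_f by (metis of_nat_add of_nat_eq_iff)
  then have eq: "{?f (n+4), ?f n} = {?f (n+3), ?f (n+2)}"
    using N(2) n(1) unfolding sidon_def by (meson atLeast_iff imageI trans_le_add1)
  \<comment> \<open>The solution is non-trivial because a gap of at least \<open>1\<close> between
    powers separates their floors; \<open>N \<ge> 1\<close> makes the exponent \<open>n-1\<close>
    legitimate.\<close>
  have "\<rho> ^ (n+4) = \<rho> ^ (n+3) + \<rho> ^ (n-1)"
    using power_rec5[of "n-1"] N(1) n(1) by (simp add: eval_nat_numeral Suc_diff_le)
  moreover have "\<rho> ^ (n-1) \<ge> 1" using gt1 by simp
  moreover have "\<rho> ^ (n+2) \<le> \<rho> ^ (n+3)" using gt1 by (intro power_increasing) auto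
  ultimately have "\<lfloor>\<rho> ^ (n+3)\<rfloor> < \<lfloor>\<rho> ^ (n+4)\<rfloor>" "\<lfloor>\<rho> ^ (n+2)\<rfloor> < \<lfloor>\<rho> ^ (n+4)\<rfloor>"
    by linarith+
  then have "?f (n+3) < ?f (n+4)" "?f (n+2) < ?f (n+4)"
    by (simp_all only: int_f[symmetric] of_nat_less_iff)
  moreover have "?f (n+4) \<in> {?f (n+3), ?f (n+2)}"
    unfolding eq[symmetric] by simp
  ultimately show False by auto
qed

end

lemma plastic_number_exists: "\<exists>\<rho>. plastic_number \<rho>"
proof -
  have "\<exists>x\<ge>1. x \<le> 2 \<and> x ^ 3 - x = (1 :: real)"
    by (intro IVT' continuous_intros) auto
  then obtain x :: real where x: "x \<ge> 1" "x ^ 3 - x = 1" by blast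
  then have "x \<noteq> 1" by auto
  with x have "plastic_number x" by unfold_locales auto
  then show ?thesis by blast
qed

theorem theorem3p1:
  fixes \<epsilon> :: real
  assumes "\<epsilon> > 0"
  shows "\<exists>x::real. x \<in> {1<..<1 + \<epsilon>} \<and> \<not> tail_sidon x"
proof -
  obtain \<rho> where "plastic_number \<rho>" using plastic_number_exists by blast
  then interpret plastic_number \<rho> .
  obtain m where m: "\<rho> < (1 + \<epsilon>) ^ m"
    using real_arch_pow[of "1 + \<epsilon>" \<rho>] assms by auto
  with gt1 have m1: "m \<ge> 1" by (cases m) auto
  define x where "x = root m \<rho>"
  have xm: "x ^ m = \<rho>" using m1 gt1 by (simp add: x_def)
  have "x > 1" using m1 gt1 by (simp add: x_def)
  moreover have "x < 1 + \<epsilon>"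
    using m assms by (intro power_less_imp_less_base[of x m "1 + \<epsilon>"]) (auto simp: xm)
  moreover have "\<not> tail_sidon x"
    using not_tail_sidon tail_sidon_power[of x m] m1 by (auto simp: xm)
  ultimately show ?thesis by auto
qed

end
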